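(* If a finite simple graph $G$ admits an MAT-labeling, then $G$ is strongly chordal.
   Context: MAT-labeling: for $\lambda:E_G\to\mathbb{Z}_{>0}$ put $\pi_k=\lambda^{-1}(k)$, $E_k=\pi_1\sqcup\dots\sqcup\pi_k$, $E_0=\varnothing$; $\operatorname{cl}(F)$ is the set of edges whose endvertices are joined by a path of edges in $F$; $\lambda$ is an MAT-labeling if for all $k\ge1$: (ML1) $\pi_k$ is a forest; (ML2) $\operatorname{cl}(\pi_k)\cap E_{k-1}=\varnothing$; (ML3) each $\{u,v\}\in\pi_k$ has exactly $k-1$ vertices $w$ with $\{u,w\},\{v,w\}\in E_{k-1}$. A graph is chordal if it has no induced cycle of length greater than three. For $n\ge3$, the $n$-sun $S_n$ has vertices $u_1,\dots,u_n,w_1,\dots,w_n$ and edges $\{u_i,u_j\}$ ($i<j$), $\{w_i,u_i\}$, $\{w_i,u_{i+1}\}$ (indices mod $n$). A graph is strongly chordal if it is chordal and has no induced subgraph isomorphic to any $S_n$, $n\ge3$. *)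

theory Defs
  imports Main
begin

text \<open>A finite simple graph is a finite vertex set \<open>V\<close> together with a set \<open>E\<close> of two-element
  subsets of \<open>V\<close>. The graph without vertices is allowed.\<close>

definition simple_graph :: "'a set \<Rightarrow> 'a set set \<Rightarrow> bool" where
  "simple_graph V E \<longleftrightarrow> finite V \<and> (\<forall>e\<in>E. e \<subseteq> V \<and> card e = 2)"

definition subgraph :: "'a set \<Rightarrow> 'a set set \<Rightarrow> 'a set \<Rightarrow> 'a set set \<Rightarrow> bool" where
  "subgraph W F V E \<longleftrightarrow> simple_graph W F \<and> W \<subseteq> V \<and> F \<subseteq> E"

definition induced_edges :: "'a set set \<Rightarrow> 'a set \<Rightarrow> 'a set set" where
  "induced_edges E W = {e \<in> E. e \<subseteq> W}"

definition graph_isomorphic :: "'a set \<Rightarrow> 'a set set \<Rightarrow> 'b set \<Rightarrow> 'b set set \<Rightarrow> bool" where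
  "graph_isomorphic V E V' E' \<longleftrightarrow>
     (\<exists>f. bij_betw f V V' \<and> (\<forall>u\<in>V. \<forall>v\<in>V. {u, v} \<in> E \<longleftrightarrow> {f u, f v} \<in> E'))"

definition has_induced_copy :: "'a set \<Rightarrow> 'a set set \<Rightarrow> 'b set \<Rightarrow> 'b set set \<Rightarrow> bool" where
  "has_induced_copy V E V' E' \<longleftrightarrow>
     (\<exists>W \<subseteq> V. graph_isomorphic W (induced_edges E W) V' E')"

text \<open>The cycle of length \<open>n\<close>, for \<open>n \<ge> 3\<close>, has vertex set \<open>{..<n}\<close>.\<close>

definition cycle_edges :: "nat \<Rightarrow> nat set set" where
  "cycle_edges n = {{i, (i + 1) mod n} | i. i < n}"

definition forest :: "'a set \<Rightarrow> 'a set set \<Rightarrow> bool" where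
  "forest V F \<longleftrightarrow>
     \<not> (\<exists>n\<ge>3. \<exists>W F'. subgraph W F' V F \<and> graph_isomorphic W F' {..<n} (cycle_edges n))"

definition chordal :: "'a set \<Rightarrow> 'a set set \<Rightarrow> bool" where
  "chordal V E \<longleftrightarrow> \<not> (\<exists>n>3. has_induced_copy V E {..<n} (cycle_edges n))"

text \<open>In the \<open>n\<close>-sun, indices run from \<open>0\<close> to \<open>n - 1\<close>; \<open>Inl i\<close> stands for the clique vertex
  $u_{i+1}$ and \<open>Inr i\<close> for $w_{i+1}$.\<close>

definition sun_verts :: "nat \<Rightarrow> (nat + nat) set" where
  "sun_verts n = Inl ` {..<n} \<union> Inr ` {..<n}"

definition sun_edges :: "nat \<Rightarrow> (nat + nat) set set" where
  "sun_edges n =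
     {{Inl i, Inl j} | i j. i < j \<and> j < n}
     \<union> {{Inr i, Inl i} | i. i < n}
     \<union> {{Inr i, Inl ((i + 1) mod n)} | i. i < n}"

definition strongly_chordal :: "'a set \<Rightarrow> 'a set set \<Rightarrow> bool" where
  "strongly_chordal V E \<longleftrightarrow>
     chordal V E \<and> \<not> (\<exists>n\<ge>3. has_induced_copy V E (sun_verts n) (sun_edges n))"

definition joined_by_path :: "'a set set \<Rightarrow> 'a \<Rightarrow> 'a \<Rightarrow> bool" where
  "joined_by_path F u v \<longleftrightarrow>
     (\<exists>p. p \<noteq> [] \<and> hd p = u \<and> last p = v \<and> distinct p
        \<and> successively (\<lambda>x y. {x, y} \<in> F) p)"

definition edge_closure :: "'a set set \<Rightarrow> 'a set set \<Rightarrow> 'a set set" where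
  "edge_closure E F = {e \<in> E. \<exists>u v. e = {u, v} \<and> joined_by_path F u v}"

definition label_class :: "'a set set \<Rightarrow> ('a set \<Rightarrow> nat) \<Rightarrow> nat \<Rightarrow> 'a set set" where
  "label_class E lab k = {e \<in> E. lab e = k}"

definition labels_upto :: "'a set set \<Rightarrow> ('a set \<Rightarrow> nat) \<Rightarrow> nat \<Rightarrow> 'a set set" where
  "labels_upto E lab k = (\<Union>i\<in>{1..k}. label_class E lab i)"

definition MAT_labeling :: "'a set \<Rightarrow> 'a set set \<Rightarrow> ('a set \<Rightarrow> nat) \<Rightarrow> bool" where
  "MAT_labeling V E lab \<longleftrightarrow>
     (\<forall>e\<in>E. lab e > 0) \<and>
     (\<forall>k\<ge>1.
        forest V (label_class E lab k) \<and>
        edge_closure E (label_class E lab k) \<inter> labels_upto E lab (k - 1) = {} \<and>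
        (\<forall>u v. {u, v} \<in> label_class E lab k \<longrightarrow>
           card {w \<in> V. {u, w} \<in> labels_upto E lab (k - 1)
                      \<and> {v, w} \<in> labels_upto E lab (k - 1)} = k - 1))"

end

theory Submission
  imports Defs
begin

text \<open>(ML1) and (ML2) say that every triangle has a strictly largest label, so by (ML3) an edge
  \<open>uv\<close> of label \<open>k\<close> is the largest edge of exactly \<open>k - 1\<close> triangles, and a clique with labels at
  most \<open>k\<close> has at most \<open>k + 1\<close> vertices.

  Chordality of the graph of edges of label at most \<open>k\<close> is proved by adding the edges one at a time:
  the apexes of the triangles with largest edge \<open>uv\<close> form a clique that separates \<open>u\<close> from \<open>v\<close> before
  \<open>uv\<close> is added. Along a shortest path avoiding them, each edge would span a clique with all of them,
  and the clique bound would force all its edges to have label \<open>k\<close>, against (ML1).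

  Let \<open>X(uv)\<close> be the clique consisting of \<open>u\<close>, \<open>v\<close> and these apexes. Counting gives
  \<open>X(ab) \<subseteq> X(uv)\<close> for all \<open>a, b \<in> X(uv)\<close>. Hence in a sun, \<open>X(u\<^sub>i u\<^sub>i\<^sub>+\<^sub>1)\<close> lies in a clique through \<open>w\<^sub>i\<close>
  and contains no third vertex \<open>u\<^sub>j\<close>. But if \<open>u\<^sub>i u\<^sub>i\<^sub>+\<^sub>1\<close> has the largest label \<open>m\<close> on the
  cycle of the \<open>u\<^sub>j\<close>, chordality of the graph of labels at most \<open>m\<close> yields such a \<open>u\<^sub>j\<close>.\<close>

section \<open>Paths as lists, cliques and triangulated cycles\<close>

abbreviation path_in :: "'a set set \<Rightarrow> 'a list \<Rightarrow> bool" where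
  "path_in F p \<equiv> distinct p \<and> successively (\<lambda>x y. {x, y} \<in> F) p"

definition clique :: "'a set set \<Rightarrow> 'a set \<Rightarrow> bool" where
  "clique F K \<longleftrightarrow> (\<forall>x\<in>K. \<forall>y\<in>K. x \<noteq> y \<longrightarrow> {x, y} \<in> F)"

text \<open>Equivalent to chordality: a triangulation of the cycle \<open>p\<close> has a triangle on the closing edge.
  This form survives the insertion of edges more easily than the absence of induced cycles.\<close>

definition cycles_triangulated :: "'a set set \<Rightarrow> bool" where
  "cycles_triangulated F \<longleftrightarrow>
     (\<forall>p. path_in F p \<and> length p \<ge> 3 \<and> {hd p, last p} \<in> F \<longrightarrow>
        (\<exists>c\<in>set p. {hd p, c} \<in> F \<and> {last p, c} \<in> F))"

lemma cycles_triangulatedD: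
  assumes "cycles_triangulated F" "path_in F p" "length p \<ge> 3" "{hd p, last p} \<in> F"
  shows "\<exists>c\<in>set p. {hd p, c} \<in> F \<and> {last p, c} \<in> F"
  using assms unfolding cycles_triangulated_def by blast

lemma successively_map_upt:
  assumes "\<And>i. Suc i < n \<Longrightarrow> P (f i) (f (Suc i))"
  shows "successively P (map f [0..<n])"
  using assms by (auto simp: successively_conv_nth)

lemma finite_nonempty_arg_max:
  fixes f :: "'b \<Rightarrow> nat"
  assumes "finite S" "S \<noteq> {}"
  shows "\<exists>x\<in>S. \<forall>y\<in>S. f y \<le> f x"
proof -
  have "Max (f ` S) \<in> f ` S" using assms by simp
  then obtain x where "x \<in> S" "f x = Max (f ` S)" by auto
  then show ?thesis using assms by (intro bexI[of _ x]) auto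
qed

text \<open>Passes from the isomorphism in the definition of \<open>forest\<close> to paths given as
  lists: a list with a closing edge carries a cycle subgraph, and the isomorphism sends each entry
  to its position.\<close>

lemma forest_no_cycle:
  assumes forest: "forest V F" and "finite V" "set p \<subseteq> V" "path_in F p" "length p \<ge> 3"
  shows "{last p, hd p} \<notin> F"
proof
  assume close: "{last p, hd p} \<in> F"
  define n where "n = length p"
  have n: "n \<ge> 3" and d: "distinct p" using assms by (auto simp: n_def)
  define F' where "F' = {{p ! i, p ! ((i + 1) mod n)} | i. i < n}"
  have inj: "inj_on ((!) p) {..<n}" using d by (simp add: n_def inj_on_nth)
  have im: "(!) p ` {..<n} = set p" by (auto simp: n_def set_conv_nth)
  have bij: "bij_betw ((!) p) {..<n} (set p)" using inj im by (simp add: bij_betw_def)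
  define f where "f = inv_into {..<n} ((!) p)"
  have bf: "bij_betw f (set p) {..<n}" unfolding f_def using bij by (rule bij_betw_inv_into)
  have fnth: "f (p ! i) = i" if "i < n" for i
    unfolding f_def using inj that by (simp add: inv_into_f_f)
  have "F' \<subseteq> F"
  proof
    fix e assume "e \<in> F'"
    then obtain i where i: "i < n" "e = {p ! i, p ! ((i + 1) mod n)}" by (auto simp: F'_def)
    show "e \<in> F"
    proof (cases "i + 1 < n")
      case True
      then show ?thesis using i assms(4) by (auto simp: successively_conv_nth n_def)
    next
      case False
      then have "Suc i = n" using i by simp
      then have "i = n - 1" "(i + 1) mod n = 0" by auto
      moreover have "p \<noteq> []" using n by (auto simp: n_def)
      ultimately show ?thesis using i close by (simp add: n_def last_conv_nth hd_conv_nth)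
    qed
  qed
  moreover have "simple_graph (set p) F'"
    unfolding simple_graph_def F'_def
  proof (clarsimp, intro conjI)
    fix i assume i: "i < n"
    have m: "Suc i mod n < n" using n by simp
    show "p ! i \<in> set p" "p ! (Suc i mod n) \<in> set p" using i m by (auto simp: n_def)
    have "i \<noteq> Suc i mod n" using i n by (cases "Suc i = n") auto
    then have "p ! i \<noteq> p ! (Suc i mod n)" using d i m by (simp add: nth_eq_iff_index_eq n_def)
    then show "card {p ! i, p ! (Suc i mod n)} = 2" by simp
  qed
  ultimately have sub: "subgraph (set p) F' V F" using assms by (simp add: subgraph_def)
  have "({p ! i, p ! j} \<in> F') = ({i, j} \<in> cycle_edges n)" if "i < n" "j < n" for i j
  proof -
    \<comment> \<open>Edges are unordered, so both sides are read as images of index sets under the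
      injective map \<open>(!) p\<close>; this avoids a case distinction on orientation.\<close>
    have "{p ! i, p ! j} = {p ! l, p ! ((l + 1) mod n)} \<longleftrightarrow> {i, j} = {l, (l + 1) mod n}"
      if "l < n" for l
    proof -
      have "(l + 1) mod n < n" using n by simp
      then have "{i, j} \<subseteq> {..<n}" "{l, (l + 1) mod n} \<subseteq> {..<n}"
        using \<open>i < n\<close> \<open>j < n\<close> \<open>l < n\<close> by auto
      from inj_on_image_eq_iff[OF inj this] show ?thesis by simp
    qed
    then show ?thesis by (auto simp: F'_def cycle_edges_def)
  qed
  then have "\<forall>u\<in>set p. \<forall>v\<in>set p. ({u, v} \<in> F') = ({f u, f v} \<in> cycle_edges n)"
    unfolding im[symmetric] using fnth by simp
  then have "graph_isomorphic (set p) F' {..<n} (cycle_edges n)"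
    unfolding graph_isomorphic_def using bf by blast
  with sub n forest show False unfolding forest_def by blast
qed

lemma path_in_insert:
  assumes "path_in (insert {u, v} F) p" "\<not> (\<exists>as a b bs. p = as @ a # b # bs \<and> {a, b} = {u, v})"
  shows "path_in F p"
proof -
  have "{p ! i, p ! Suc i} \<in> F" if "Suc i < length p" for i
  proof -
    have "p = take i p @ p ! i # p ! Suc i # drop (Suc (Suc i)) p"
      using that by (metis Cons_nth_drop_Suc Suc_lessD append_take_drop_id)
    with assms(2) have "{p ! i, p ! Suc i} \<noteq> {u, v}" by blast
    then show ?thesis using assms(1) that by (auto simp: successively_conv_nth)
  qed
  then show ?thesis using assms(1) by (simp add: successively_conv_nth)
qed

section \<open>Triangles and cliques in an MAT-labeled graph\<close>

locale MAT_graph =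
  fixes V :: "'a set" and E :: "'a set set" and lab :: "'a set \<Rightarrow> nat"
  assumes simple: "simple_graph V E" and MAT: "MAT_labeling V E lab"
begin

abbreviation L :: "nat \<Rightarrow> 'a set set" where "L \<equiv> labels_upto E lab"

text \<open>For an edge \<open>uv\<close> this is the set counted in (ML3), written without
  reference to \<open>k\<close>.\<close>

definition lower_nbrs :: "'a \<Rightarrow> 'a \<Rightarrow> 'a set" where
  "lower_nbrs u v = {w. {u, w} \<in> E \<and> {v, w} \<in> E \<and> lab {u, w} < lab {u, v} \<and> lab {v, w} < lab {u, v}}"

lemma finite_V: "finite V"
  and edge_subset: "e \<in> E \<Longrightarrow> e \<subseteq> V"
  and edge_card: "e \<in> E \<Longrightarrow> card e = 2"
  using simple by (auto simp: simple_graph_def)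

lemma finite_E: "finite E"
  using finite_subset[of E "Pow V"] finite_V edge_subset by auto

lemma edge_irrefl: "{x, x} \<notin> E"
  using edge_card[of "{x}"] by auto

lemma lab_pos: "e \<in> E \<Longrightarrow> lab e > 0"
  using MAT by (auto simp: MAT_labeling_def)

lemma L_iff: "e \<in> L k \<longleftrightarrow> e \<in> E \<and> lab e \<le> k"
  using lab_pos[of e] by (auto simp: labels_upto_def label_class_def)

lemma class_forest: "k \<ge> 1 \<Longrightarrow> forest V (label_class E lab k)"
  using MAT by (auto simp: MAT_labeling_def)

lemma class_no_cycle:
  assumes "path_in (label_class E lab k) p" "length p \<ge> 3"
  shows "{last p, hd p} \<notin> label_class E lab k"
proof
  assume last: "{last p, hd p} \<in> label_class E lab k"
  then have k: "k \<ge> 1" using lab_pos by (force simp: label_class_def)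
  have "x \<in> V" if x: "x \<in> set p" for x
  proof -
    obtain i where i: "i < length p" "x = p ! i" using x by (metis in_set_conv_nth)
    show ?thesis
    proof (cases "Suc i < length p")
      case True
      then have "{p ! i, p ! Suc i} \<in> E"
        using assms(1) by (auto simp: successively_conv_nth label_class_def)
      then show ?thesis using i edge_subset by blast
    next
      case False
      then have "i = length p - 1" using i by simp
      then have "x = last p" using i by (metis last_conv_nth length_greater_0_conv gr_implies_not0 list.size(3))
      then show ?thesis using last edge_subset by (auto simp: label_class_def)
    qed
  qed
  then have "set p \<subseteq> V" by blast
  from forest_no_cycle[OF class_forest[OF k] finite_V this assms] last show False by blast
qed

text \<open>Two edges of equal label \<open>k\<close> join \<open>x\<close> to \<open>z\<close>
  inside the class of \<open>k\<close>. A third edge of label \<open>k\<close> would close a cycle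
  in that forest, against (ML1), and one of smaller label would lie in the closure of the class,
  against (ML2).\<close>

lemma triangle_third:
  assumes "{x, y} \<in> E" "{y, z} \<in> E" "{x, z} \<in> E" "lab {x, y} = lab {y, z}"
  shows "lab {x, y} < lab {x, z}"
proof (rule ccontr)
  assume le: "\<not> ?thesis"
  let ?k = "lab {x, y}"
  have ne: "x \<noteq> y" "y \<noteq> z" "x \<noteq> z" using assms edge_irrefl by auto
  have p: "path_in (label_class E lab ?k) [x, y, z]"
    using ne assms by (auto simp: label_class_def)
  from class_no_cycle[OF p] have "lab {x, z} \<noteq> ?k"
    using assms by (auto simp: label_class_def insert_commute)
  with le have "{x, z} \<in> L (?k - 1)" using assms by (auto simp: L_iff)
  moreover have "joined_by_path (label_class E lab ?k) x z"
    unfolding joined_by_path_def using p by (intro exI[of _ "[x, y, z]"]) auto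
  then have "{x, z} \<in> edge_closure E (label_class E lab ?k)"
    using assms by (auto simp: edge_closure_def)
  moreover have "?k \<ge> 1" using lab_pos[OF assms(1)] by simp
  ultimately show False using MAT unfolding MAT_labeling_def by blast
qed

text \<open>If another edge tied with \<open>xy\<close>, then \<open>triangle_third\<close> would
  make the remaining edge larger than \<open>xy\<close>.\<close>

lemma triangle_max_strict:
  assumes "{x, y} \<in> E" "{y, z} \<in> E" "{x, z} \<in> E"
    and "lab {y, z} \<le> lab {x, y}" "lab {x, z} \<le> lab {x, y}"
  shows "z \<in> lower_nbrs x y"
  using triangle_third[of x y z] triangle_third[of y x z] assms
  by (auto simp: lower_nbrs_def insert_commute order.strict_iff_order)

lemma lower_nbrs_commute: "lower_nbrs x y = lower_nbrs y x"
  by (auto simp: lower_nbrs_def insert_commute)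

lemma lower_nbrs_subset_V: "lower_nbrs u v \<subseteq> V"
  using edge_subset by (auto simp: lower_nbrs_def)

lemma finite_lower_nbrs: "finite (lower_nbrs u v)"
  using lower_nbrs_subset_V finite_V by (rule finite_subset)

lemma not_in_lower_nbrs: "u \<notin> lower_nbrs u v \<and> v \<notin> lower_nbrs u v"
  using edge_irrefl by (auto simp: lower_nbrs_def)

lemma card_lower_nbrs:
  assumes "{u, v} \<in> E"
  shows "card (lower_nbrs u v) = lab {u, v} - 1"
proof -
  have k: "lab {u, v} \<ge> 1" using lab_pos[OF assms] by simp
  have "{u, v} \<in> label_class E lab (lab {u, v})" using assms by (simp add: label_class_def)
  then have "card {w \<in> V. {u, w} \<in> L (lab {u, v} - 1) \<and> {v, w} \<in> L (lab {u, v} - 1)} = lab {u, v} - 1"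
    using MAT k unfolding MAT_labeling_def by blast
  moreover have "{w \<in> V. {u, w} \<in> L (lab {u, v} - 1) \<and> {v, w} \<in> L (lab {u, v} - 1)} = lower_nbrs u v"
    using k edge_subset by (auto simp: lower_nbrs_def L_iff)
  ultimately show ?thesis by simp
qed

text \<open>All vertices of \<open>K\<close> off an edge of largest label in \<open>K\<close> are
  lower neighbours of that edge, and (ML3) leaves room for at most \<open>k - 1\<close> of
  them.\<close>

lemma clique_card_le:
  assumes K: "clique (L k) K" and "finite K"
  shows "card K \<le> k + 1"
proof (cases "\<exists>x\<in>K. \<exists>y\<in>K. x \<noteq> y")
  case False
  then have "card K \<le> 1" by (metis card_le_Suc0_iff_eq One_nat_def assms(2))
  then show ?thesis by simp
next
  case True
  let ?S = "{{x, y} | x y. x \<in> K \<and> y \<in> K \<and> x \<noteq> y}"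
  have "?S \<subseteq> E" using K by (auto simp: clique_def L_iff)
  then have "finite ?S" using finite_E finite_subset by blast
  moreover have "?S \<noteq> {}" using True by auto
  ultimately obtain e where e: "e \<in> ?S" "\<And>e'. e' \<in> ?S \<Longrightarrow> lab e' \<le> lab e"
    using finite_nonempty_arg_max[of ?S lab] by blast
  then obtain x y where xy: "e = {x, y}" "x \<in> K" "y \<in> K" "x \<noteq> y" by auto
  have E: "{a, b} \<in> E" if "a \<in> K" "b \<in> K" "a \<noteq> b" for a b
    using K that by (auto simp: clique_def L_iff)
  have "K - {x, y} \<subseteq> lower_nbrs x y"
  proof
    fix z assume z: "z \<in> K - {x, y}"
    show "z \<in> lower_nbrs x y"
      using z xy by (intro triangle_max_strict E e(2)[unfolded xy(1)]) auto
  qed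
  then have "card (K - {x, y}) \<le> card (lower_nbrs x y)"
    using finite_lower_nbrs card_mono by blast
  also have "\<dots> = lab {x, y} - 1" using xy E card_lower_nbrs by simp
  also have "\<dots> \<le> k - 1" using K xy by (auto simp: clique_def L_iff intro: diff_le_mono)
  finally have "card K - 2 \<le> k - 1"
    using xy assms(2) by (simp add: card_Diff_subset)
  \<comment> \<open>For \<open>k = 0\<close> the truncated subtractions above would only give
    \<open>card K <= 2\<close>.\<close>
  moreover have "k \<ge> 1" using K xy lab_pos[OF E[OF xy(2,3,4)]] unfolding clique_def L_iff
    by (metis One_nat_def Suc_leI less_le_trans)
  ultimately show ?thesis by simp
qed

section \<open>Chordality of the graphs of edges of bounded label\<close>

lemma lower_nbrs_clique:
  assumes ch: "cycles_triangulated (L (k - 1))" and uv: "{u, v} \<in> E" "lab {u, v} = k"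
  shows "clique (L (k - 1)) (lower_nbrs u v)"
  unfolding clique_def
proof (intro ballI impI)
  fix a b assume ab: "a \<in> lower_nbrs u v" "b \<in> lower_nbrs u v" "a \<noteq> b"
  have k: "k \<ge> 1" using lab_pos uv by force
  \<comment> \<open>The apexes \<open>a\<close> and \<open>b\<close> form a 4-cycle with
    \<open>u\<close> and \<open>v\<close> in labels below \<open>k\<close>. The diagonal
    \<open>uv\<close> has label \<open>k\<close>, so a triangulation must use the diagonal
    \<open>ab\<close>.\<close>
  have "path_in (L (k - 1)) [u, a, v, b]" "{u, b} \<in> L (k - 1)"
    using ab uv k edge_irrefl not_in_lower_nbrs[of u v]
    by (auto simp: lower_nbrs_def L_iff insert_commute)
  from cycles_triangulatedD[OF ch this(1)] this(2)
  have "\<exists>c\<in>set [u, a, v, b]. {u, c} \<in> L (k - 1) \<and> {b, c} \<in> L (k - 1)"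
    by (simp del: bex_simps)
  then obtain c where "c \<in> {u, a, v, b}" "{u, c} \<in> L (k - 1)" "{b, c} \<in> L (k - 1)"
    by (metis list.set(1) list.simps(15))
  then show "{a, b} \<in> L (k - 1)"
    using uv k edge_irrefl by (auto simp: L_iff insert_commute)
qed

text \<open>Here \<open>H\<close> is an intermediate stage, with some of the edges of label
  \<open>k\<close> already inserted. A path avoiding the apexes can be taken shortest; it turns out
  to consist of edges of label \<open>k\<close> only, and \<open>uv\<close> closes it to a cycle in
  one label class.\<close>

lemma lower_nbrs_separate:
  assumes chL: "cycles_triangulated (L (k - 1))" and ch: "cycles_triangulated H"
    and H: "L (k - 1) \<subseteq> H" "H \<subseteq> L k"
    and uv: "{u, v} \<in> E" "lab {u, v} = k" "{u, v} \<notin> H"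
    and q: "path_in H q" "q \<noteq> []" "hd q = u" "last q = v"
  shows "set q \<inter> lower_nbrs u v \<noteq> {}"
proof
  let ?N = "lower_nbrs u v"
  let ?Q = "\<lambda>q. path_in H q \<and> q \<noteq> [] \<and> hd q = u \<and> last q = v \<and> set q \<inter> ?N = {}"
  assume "set q \<inter> ?N = {}"
  then have "?Q q" using q by simp
  then obtain p where p: "?Q p" and short: "\<And>p'. ?Q p' \<Longrightarrow> length p \<le> length p'"
    using ex_has_least_nat[of ?Q q length] by blast
  define l where "l = length p - 1"
  have lenp: "length p = Suc l" using p by (cases p) (auto simp: l_def)
  have p0: "p ! 0 = u" and pl: "p ! l = v" using p lenp by (auto simp: hd_conv_nth last_conv_nth l_def)
  have k: "k \<ge> 1" using lab_pos uv by force
  have HE: "e \<in> E" "lab e \<le> k" if "e \<in> H" for e using that H by (auto simp: L_iff)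
  have HI: "e \<in> H" if "e \<in> E" "lab e < k" for e using that H by (auto simp: L_iff)
  have dp: "distinct p" using p by simp
  have step: "{p ! i, p ! Suc i} \<in> H" if "i < l" for i
    using p that lenp by (auto simp: successively_conv_nth)
  \<comment> \<open>A chord from \<open>p ! i\<close> to \<open>p ! j\<close> with
    \<open>j > i + 1\<close> would cut out the part between them and give a shorter path that still
    avoids the apexes.\<close>
  have induced: "j \<le> Suc i" if "i < j" "j \<le> l" "{p ! i, p ! j} \<in> H" for i j
  proof -
    let ?p = "take (Suc i) p @ drop j p"
    have "set (take (Suc i) p) \<inter> set (drop j p) = {}"
      using dp that by (simp add: set_take_disj_set_drop_if_distinct)
    moreover have "last (take (Suc i) p) = p ! i" "hd (drop j p) = p ! j"
      using that lenp by (auto simp: take_Suc_conv_app_nth hd_drop_conv_nth)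
    moreover have "successively (\<lambda>x y. {x, y} \<in> H) (take (Suc i) p)"
      "successively (\<lambda>x y. {x, y} \<in> H) (drop j p)"
      using p by (auto simp: successively_conv_nth)
    moreover have "hd ?p = u" "last ?p = v"
      using p that lenp by (auto simp: hd_append)
    moreover have "set ?p \<inter> ?N = {}" using p set_take_subset[of "Suc i" p] set_drop_subset[of j p] by auto
    ultimately have "?Q ?p" using dp that lenp by (auto simp: successively_append_iff)
    from short[OF this] show ?thesis using that lenp by simp
  qed
  have notN: "p ! i \<notin> ?N" if "i \<le> l" for i
    using p that lenp by (metis disjoint_iff le_imp_less_Suc nth_mem)
  \<comment> \<open>Adjacency to \<open>w\<close> spreads along the path: the rest of the path from
    \<open>p ! i\<close> to \<open>v\<close>, followed by \<open>w\<close>, is a cycle with closing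
    edge from \<open>p ! i\<close> to \<open>w\<close>. The apex of a triangle on this edge is a
    path vertex, and as the path is induced it is \<open>p ! Suc i\<close>.\<close>
  have adj: "{w, p ! i} \<in> H" if "w \<in> ?N" "i \<le> l" for w i
    using that(2)
  proof (induction i)
    case 0
    then show ?case using that uv p0 by (auto simp: lower_nbrs_def insert_commute intro: HI)
  next
    case (Suc i)
    let ?p = "drop i p @ [w]"
    have i: "i < length p" using Suc.prems lenp by simp
    have wv: "{v, w} \<in> H" using that uv by (auto simp: lower_nbrs_def intro: HI)
    have "w \<notin> set (drop i p)" using p that in_set_dropD by fastforce
    moreover have "successively (\<lambda>x y. {x, y} \<in> H) (drop i p)"
      using p by (auto simp: successively_conv_nth)
    ultimately have "path_in H ?p" using dp p i wv by (auto simp: successively_append_iff)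
    moreover have hd: "hd ?p = p ! i" using i by (simp add: hd_drop_conv_nth)
    moreover have "length ?p \<ge> 3" using Suc.prems lenp by simp
    moreover have last: "last ?p = w" by simp
    moreover have "{p ! i, w} \<in> H" using Suc by (simp add: insert_commute)
    ultimately have "\<exists>c\<in>set ?p. {p ! i, c} \<in> H \<and> {w, c} \<in> H"
      using cycles_triangulatedD[OF ch, of ?p] unfolding hd last by blast
    then obtain c where c: "c \<in> set ?p" "{p ! i, c} \<in> H" "{w, c} \<in> H" by blast
    then have "c \<in> set (drop i p)" using edge_irrefl HE(1)[OF c(3)] by auto
    then obtain m where m: "m < length (drop i p)" "c = drop i p ! m" by (auto simp: in_set_conv_nth)
    then have j: "c = p ! (i + m)" "i + m \<le> l" using lenp by auto
    have "m \<noteq> 0" using c(2) j edge_irrefl HE(1) by (metis add_0_right)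
    with induced[of i "i + m"] c j have "m = 1" by simp
    then show ?case using c j by simp
  qed
  have Nclique: "clique (L (k - 1)) ?N" using lower_nbrs_clique[OF chL] uv by simp
  have NN: "{a, b} \<in> H" if "a \<in> ?N" "b \<in> ?N" "a \<noteq> b" for a b
    using Nclique that H by (auto simp: clique_def)
  have max: "z \<in> lower_nbrs x y" if "{x, y} \<in> H" "{y, z} \<in> H" "{x, z} \<in> H" "lab {x, y} = k" for x y z
    using that by (intro triangle_max_strict) (auto dest: HE)
  \<comment> \<open>Otherwise \<open>p ! i\<close> is an inner vertex, and the \<open>k - 2\<close>
    other apexes together with its two neighbours on the path are \<open>k\<close> lower neighbours
    of an edge of label \<open>k\<close>, one too many.\<close>
  have low: "lab {w, p ! i} \<noteq> k" if w: "w \<in> ?N" and i: "i \<le> l" for w i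
  proof
    assume eq: "lab {w, p ! i} = k"
    have "lab {w, u} \<noteq> k" "lab {w, v} \<noteq> k" using w uv by (auto simp: lower_nbrs_def insert_commute)
    then have "i \<noteq> 0" "i \<noteq> l" using eq p0 pl by metis+
    then obtain i' where i': "i = Suc i'" "i < l" using i by (cases i) auto
    let ?M = "(?N - {w}) \<union> {p ! i', p ! Suc i}"
    have "?M \<subseteq> lower_nbrs w (p ! i)"
      using w i i' adj NN step[of i'] step[of i] eq
      by (auto intro!: max simp: insert_commute)
    then have "card ?M \<le> k - 1"
      using card_mono[OF finite_lower_nbrs] card_lower_nbrs[of w "p ! i"] HE(1)[OF adj[OF w i]] eq
      by metis
    moreover have "p ! i' \<noteq> p ! Suc i" using dp i' lenp by (simp add: nth_eq_iff_index_eq)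
    then have "card ?M = card (?N - {w}) + 2"
      using notN[of i'] notN[of "Suc i"] i' finite_lower_nbrs
      by (subst card_Un_disjoint) auto
    moreover have "card (?N - {w}) = k - 1 - 1" "k - 1 \<ge> 1"
      using w finite_lower_nbrs card_lower_nbrs[OF uv(1)] uv(2) card_gt_0_iff[of ?N] by auto
    ultimately show False by simp
  qed
  \<comment> \<open>A path edge of smaller label would form with the \<open>k - 1\<close> apexes a
    clique of \<open>k + 1\<close> vertices in \<open>L (k - 1)\<close>, where at most
    \<open>k\<close> are possible.\<close>
  have "{p ! i, p ! Suc i} \<in> label_class E lab k" if i: "i < l" for i
  proof (rule ccontr)
    assume "\<not> ?thesis"
    then have "lab {p ! i, p ! Suc i} < k" using HE[OF step[OF i]] by (auto simp: label_class_def)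
    then have base: "{p ! i, p ! Suc i} \<in> L (k - 1)" using HE[OF step[OF i]] by (auto simp: L_iff)
    have wL: "{w, p ! j} \<in> L (k - 1)" if "w \<in> ?N" "j \<le> l" for w j
      using HE[OF adj[OF that]] low[OF that] by (auto simp: L_iff)
    let ?K = "?N \<union> {p ! i, p ! Suc i}"
    have "clique (L (k - 1)) ?K"
      using Nclique base wL[of _ i] wL[of _ "Suc i"] i
      by (auto simp: clique_def insert_commute)
    then have "card ?K \<le> k" using clique_card_le[of "k - 1" ?K] finite_lower_nbrs k by simp
    moreover have "p ! i \<noteq> p ! Suc i" using dp i lenp by (simp add: nth_eq_iff_index_eq)
    then have "card ?K = card ?N + 2"
      using notN[of i] notN[of "Suc i"] i finite_lower_nbrs by (subst card_Un_disjoint) auto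
    ultimately show False using card_lower_nbrs[OF uv(1)] uv(2) by simp
  qed
  then have "path_in (label_class E lab k) p" using dp lenp by (auto simp: successively_conv_nth)
  \<comment> \<open>The path has at least three vertices, since \<open>u\<close> and
    \<open>v\<close> are distinct and \<open>uv\<close> is not yet in \<open>H\<close>.\<close>
  moreover have "l \<noteq> 0" using p0 pl uv(1) edge_irrefl[of u] by metis
  moreover have "l \<noteq> 1" using step[of 0] p0 pl uv by auto
  ultimately have "{last p, hd p} \<notin> label_class E lab k" using class_no_cycle lenp by simp
  then show False using p uv by (auto simp: label_class_def insert_commute)
qed

text \<open>If \<open>uv\<close> is the closing edge, separation puts an apex on the path. If
  \<open>uv\<close> is absent from the cycle, \<open>H\<close> suffices. If \<open>uv\<close> lies
  inside the path, the cycle is opened at \<open>uv\<close> instead, and the apex found there gives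
  a shortcut past \<open>uv\<close> or past the closing edge's partner path.\<close>

lemma cycles_triangulated_insert:
  assumes chL: "cycles_triangulated (L (k - 1))" and ch: "cycles_triangulated H"
    and H: "L (k - 1) \<subseteq> H" "H \<subseteq> L k"
    and uv: "{u, v} \<in> E" "lab {u, v} = k" "{u, v} \<notin> H"
  shows "cycles_triangulated (insert {u, v} H)"
  unfolding cycles_triangulated_def
proof (intro allI impI, elim conjE)
  let ?H = "insert {u, v} H"
  fix p assume d: "distinct p" and s: "successively (\<lambda>x y. {x, y} \<in> ?H) p"
    and len: "length p \<ge> 3" and close: "{hd p, last p} \<in> ?H"
  have HI: "{u, w} \<in> H" "{v, w} \<in> H" if "w \<in> lower_nbrs u v" for w
    using that uv H by (auto simp: lower_nbrs_def L_iff)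
  have sep: "\<exists>c\<in>set q. {a, c} \<in> H \<and> {b, c} \<in> H"
    if "{a, b} = {u, v}" "path_in H q" "q \<noteq> []" "hd q = a" "last q = b" for q a b
  proof -
    have eq: "lower_nbrs a b = lower_nbrs u v"
      using that(1) lower_nbrs_commute by (auto simp: doubleton_eq_iff)
    have "{a, b} \<in> E" "lab {a, b} = k" "{a, b} \<notin> H" using uv that(1) by simp_all
    from lower_nbrs_separate[OF chL ch H this that(2-)] eq
    obtain c where "c \<in> set q" "c \<in> lower_nbrs u v" by auto
    then show ?thesis using HI that(1) by (auto simp: doubleton_eq_iff)
  qed
  show "\<exists>c\<in>set p. {hd p, c} \<in> ?H \<and> {last p, c} \<in> ?H"
  proof (cases "\<exists>as a b bs. p = as @ a # b # bs \<and> {a, b} = {u, v}")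
    case False
    then have pH: "path_in H p" using path_in_insert[where u = u and v = v] d s by simp
    show ?thesis
    proof (cases "{hd p, last p} = {u, v}")
      case True
      then show ?thesis using sep[OF True pH] len by fastforce
    next
      case False
      then have "{hd p, last p} \<in> H" using close by blast
      then show ?thesis using cycles_triangulatedD[OF ch pH len] by blast
    qed
  next
    case True
    then obtain as a b bs where p: "p = as @ a # b # bs" and ab: "{a, b} = {u, v}" by blast
    \<comment> \<open>By distinctness each half of \<open>p\<close> misses one end of the new edge,
      so both halves are paths in \<open>H\<close>.\<close>
    have as: "path_in H (as @ [a])"
    proof (rule path_in_insert)
      show "path_in ?H (as @ [a])" using d s by (auto simp: p successively_append_iff successively_Cons)
      have "b \<notin> set (as @ [a])" using d by (auto simp: p)
      then show "\<not> (\<exists>xs x y ys. as @ [a] = xs @ x # y # ys \<and> {x, y} = {u, v})"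
        unfolding ab[symmetric] doubleton_eq_iff
        by (metis in_set_conv_decomp append.assoc append_Cons append_Nil)
    qed
    have bs: "path_in H (b # bs)"
    proof (rule path_in_insert)
      show "path_in ?H (b # bs)" using d s by (auto simp: p successively_append_iff successively_Cons)
      have "a \<notin> set (b # bs)" using d by (auto simp: p)
      then show "\<not> (\<exists>xs x y ys. b # bs = xs @ x # y # ys \<and> {x, y} = {u, v})"
        unfolding ab[symmetric] doubleton_eq_iff
        by (metis in_set_conv_decomp append.assoc append_Cons append_Nil)
    qed
    have hd: "hd p = hd (as @ [a])" by (cases as) (auto simp: p)
    have last: "last p = last (b # bs)" by (simp add: p)
    have "as \<noteq> [] \<or> bs \<noteq> []" using len by (auto simp: p)
    then have "{hd p, last p} \<noteq> {a, b}"
      using d by (cases as; cases bs rule: rev_cases) (auto simp: p doubleton_eq_iff)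
    then have closeH: "{hd p, last p} \<in> H" using close ab by auto
    \<comment> \<open>The cycle, opened at the new edge: from \<open>b\<close> to the end of
      \<open>p\<close>, across the closing edge, and from the start of \<open>p\<close> to
      \<open>a\<close>.\<close>
    have "path_in H ((b # bs) @ (as @ [a]))"
    proof
      show "distinct ((b # bs) @ (as @ [a]))" using d by (auto simp: p)
      show "successively (\<lambda>x y. {x, y} \<in> H) ((b # bs) @ (as @ [a]))"
        unfolding successively_append_iff[of _ "b # bs"]
        using as bs closeH unfolding hd last by (simp add: insert_commute)
    qed
    moreover have "{b, a} = {u, v}" using ab by (simp add: insert_commute)
    ultimately have "\<exists>c\<in>set ((b # bs) @ (as @ [a])). {b, c} \<in> H \<and> {a, c} \<in> H"
      by (intro sep) auto
    then obtain c where c: "c \<in> set (b # bs) \<union> set (as @ [a])" "{a, c} \<in> H" "{b, c} \<in> H"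
      by (metis set_append)
    have "{a, b} \<notin> H" using uv ab by simp
    moreover have "{a, a} \<notin> H" using H edge_irrefl by (auto simp: L_iff)
    ultimately have "c \<noteq> a" "c \<noteq> b" using c by metis+
    with c consider "c \<in> set as" | "c \<in> set bs" by auto
    then show ?thesis
    proof cases
      case 1
      then obtain as1 as2 where as12: "as = as1 @ c # as2" by (meson split_list)
      \<comment> \<open>Going from \<open>c\<close> straight to \<open>b\<close> bypasses the new
        edge and keeps both ends of \<open>p\<close>, so the closing edge gets its triangle inside
        \<open>H\<close>.\<close>
      let ?p = "(as1 @ [c]) @ b # bs"
      have path: "path_in H ?p"
        using as bs d c by (auto simp: p as12 successively_append_iff successively_Cons insert_commute)
      have ends: "hd ?p = hd p" "last ?p = last p" by (cases as1; simp add: p as12)+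
      show ?thesis
      proof (cases "length ?p \<ge> 3")
        case True
        have "set ?p \<subseteq> set p" by (auto simp: p as12)
        then show ?thesis
          using cycles_triangulatedD[OF ch path True, unfolded ends, OF closeH] by blast
      next
        case False
        \<comment> \<open>The shortcut is the closing edge \<open>cb\<close> itself; its triangle
          has apex \<open>a\<close> and uses the new edge.\<close>
        then have "as1 = []" "bs = []" by (auto simp: Suc_le_eq)
        then have "hd p = c" "last p = b" by (auto simp: p as12)
        moreover have "{c, a} \<in> H" "{b, a} \<in> ?H" using c unfolding ab[symmetric] by (simp_all add: insert_commute)
        ultimately show ?thesis by (intro bexI[of _ a]) (auto simp: p)
      qed
    next
      case 2
      then obtain bs1 bs2 where bs12: "bs = bs1 @ c # bs2" by (meson split_list)
      let ?p = "(as @ [a]) @ c # bs2"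
      have path: "path_in H ?p"
        using as bs d c by (auto simp: p bs12 successively_append_iff successively_Cons insert_commute)
      have ends: "hd ?p = hd p" "last ?p = last p" by (cases as; simp add: p bs12)+
      show ?thesis
      proof (cases "length ?p \<ge> 3")
        case True
        have "set ?p \<subseteq> set p" by (auto simp: p bs12)
        then show ?thesis
          using cycles_triangulatedD[OF ch path True, unfolded ends, OF closeH] by blast
      next
        case False
        then have "as = []" "bs2 = []" by (auto simp: Suc_le_eq)
        then have "hd p = a" "last p = c" by (auto simp: p bs12)
        moreover have "{c, b} \<in> H" "{a, b} \<in> ?H" using c unfolding ab[symmetric] by (simp_all add: insert_commute)
        ultimately show ?thesis by (intro bexI[of _ b]) (auto simp: p)
      qed
    qed
  qed
qed

text \<open>The edges of label \<open>Suc k\<close> are inserted into \<open>L k\<close> one by one,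
  in arbitrary order.\<close>

lemma cycles_triangulated_L: "cycles_triangulated (L k)"
proof (induction k)
  case 0
  have "L 0 = {}" by (simp add: labels_upto_def)
  then show ?case by (simp add: cycles_triangulated_def)
next
  case (Suc k)
  let ?C = "label_class E lab (Suc k)"
  have fin: "finite ?C" using finite_E by (simp add: label_class_def)
  have "cycles_triangulated (L k \<union> S)" if "finite S" "S \<subseteq> ?C" for S
    using that
  proof (induction S)
    case empty
    then show ?case using Suc by simp
  next
    case (insert e S)
    then have e: "e \<in> E" "lab e = Suc k" by (auto simp: label_class_def)
    then obtain u v where "e = {u, v}" using edge_card by (metis card_2_iff)
    moreover have "e \<notin> L k \<union> S" using insert e by (auto simp: L_iff)
    ultimately have "cycles_triangulated (insert e (L k \<union> S))"
      using insert e Suc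
      by (auto intro!: cycles_triangulated_insert[where k = "Suc k"] simp: L_iff label_class_def)
    then show ?case by simp
  qed
  from this[OF fin subset_refl] show ?case
    by (simp add: labels_upto_def atLeastAtMostSuc_conv Un_commute)
qed

lemma cycles_triangulated_E: "cycles_triangulated E"
proof -
  \<comment> \<open>For empty \<open>E\<close> the maximum is unspecified, but then both sides are
    empty.\<close>
  have "L (Max (lab ` E)) = E" using finite_E by (auto simp: L_iff)
  then show ?thesis using cycles_triangulated_L by metis
qed

section \<open>The principal cliques \<open>X(uv)\<close> and their nesting\<close>

definition principal_clique :: "'a \<Rightarrow> 'a \<Rightarrow> 'a set" where
  "principal_clique u v = insert u (insert v (lower_nbrs u v))"

lemma principal_clique_commute: "principal_clique u v = principal_clique v u"
  by (auto simp: principal_clique_def lower_nbrs_commute)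

lemma clique_insert_lower_nbrs:
  assumes "{u, v} \<in> E"
  shows "clique (L (lab {u, v} - 1)) (insert u (lower_nbrs u v))"
proof -
  have uw: "{u, w} \<in> L (lab {u, v} - 1)" if "w \<in> lower_nbrs u v" for w
    using that by (auto simp: lower_nbrs_def L_iff)
  then show ?thesis
    using lower_nbrs_clique[OF cycles_triangulated_L assms refl] uw
    unfolding clique_def by (auto simp: insert_commute[of _ u])
qed

lemma principal_clique_clique:
  assumes "{u, v} \<in> E" shows "clique E (principal_clique u v)"
proof -
  have "clique E (insert u (lower_nbrs u v))" "clique E (insert v (lower_nbrs u v))"
    using clique_insert_lower_nbrs[of u v] clique_insert_lower_nbrs[of v u] assms
      lower_nbrs_commute[of u v] insert_commute[of u v "{}"]
    unfolding clique_def L_iff by metis+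
  then show ?thesis
    using assms insert_commute[of u v "{}"] unfolding clique_def principal_clique_def
    by (metis insert_iff)
qed

text \<open>This size is the upper bound of \<open>clique_card_le\<close> for labels up to that of
  \<open>uv\<close>.\<close>

lemma card_principal_clique:
  assumes "{u, v} \<in> E" shows "card (principal_clique u v) = lab {u, v} + 1"
proof -
  have "u \<noteq> v" using assms edge_irrefl by auto
  then show ?thesis
    using not_in_lower_nbrs[of u v] finite_lower_nbrs card_lower_nbrs[OF assms] lab_pos[OF assms]
    by (simp add: principal_clique_def)
qed

text \<open>Deleting an endpoint of its largest edge from a principal clique leaves a principal clique,
  because a clique of size \<open>k\<close> must contain an edge of label at least \<open>k - 1\<close>.\<close>

lemma principal_clique_child:
  assumes uv: "{u, v} \<in> E" and k: "lab {u, v} > 1"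
  obtains x y where "{x, y} \<in> E" "lab {x, y} < lab {u, v}"
    "principal_clique x y = insert u (lower_nbrs u v)"
proof -
  let ?k = "lab {u, v}" and ?K = "insert u (lower_nbrs u v)"
  have K: "clique (L (?k - 1)) ?K" by (rule clique_insert_lower_nbrs[OF uv])
  have cK: "card ?K = ?k"
    using not_in_lower_nbrs[of u v] finite_lower_nbrs card_lower_nbrs[OF uv] k by simp
  have "\<not> clique (L (?k - 2)) ?K"
  proof
    assume "clique (L (?k - 2)) ?K"
    from clique_card_le[OF this] cK k finite_lower_nbrs show False by simp
  qed
  then obtain x y where xy: "x \<in> ?K" "y \<in> ?K" "x \<noteq> y" "{x, y} \<notin> L (?k - 2)"
    unfolding clique_def by blast
  with K have e: "{x, y} \<in> L (?k - 1)" by (auto simp: clique_def)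
  with xy have xyE: "{x, y} \<in> E" and lab: "lab {x, y} = ?k - 1" using k by (auto simp: L_iff)
  have KE: "{a, b} \<in> E \<and> lab {a, b} \<le> lab {x, y}" if "a \<in> ?K" "b \<in> ?K" "a \<noteq> b" for a b
    using K that lab unfolding clique_def L_iff by metis
  have "?K \<subseteq> principal_clique x y"
  proof
    fix z assume z: "z \<in> ?K"
    show "z \<in> principal_clique x y"
    proof (cases "z = x \<or> z = y")
      case False
      then have "z \<in> lower_nbrs x y" using KE xy z by (intro triangle_max_strict) auto
      then show ?thesis by (simp add: principal_clique_def)
    qed (auto simp: principal_clique_def)
  qed
  \<comment> \<open>Both sets have \<open>?k\<close> vertices, so the inclusion is an
    equality.\<close>
  moreover have "card (principal_clique x y) = card ?K"
    using card_principal_clique[OF xyE] lab cK k by simp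
  moreover have "finite (principal_clique x y)"
    using finite_lower_nbrs by (simp add: principal_clique_def)
  ultimately have "?K = principal_clique x y" by (metis card_subset_eq)
  with that[OF xyE] lab k show thesis by simp
qed

text \<open>Induction on the label of \<open>uv\<close>. Unless \<open>ab\<close> is
  \<open>uv\<close>, some end of \<open>uv\<close> is neither \<open>a\<close> nor \<open>b\<close>;
  deleting it leaves the principal clique of an edge of smaller label that still contains
  \<open>a\<close> and \<open>b\<close>.\<close>

lemma principal_clique_mono:
  assumes "{u, v} \<in> E" "a \<in> principal_clique u v" "b \<in> principal_clique u v" "a \<noteq> b"
  shows "principal_clique a b \<subseteq> principal_clique u v"
  using assms
proof (induction "lab {u, v}" arbitrary: u v rule: less_induct)
  case less
  have step: ?case if xy: "{x, y} = {u, v}" and "y \<noteq> a" "y \<noteq> b" for x y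
  proof -
    have pc: "principal_clique x y = principal_clique u v"
      using xy principal_clique_commute by (auto simp: doubleton_eq_iff)
    have xyE: "{x, y} \<in> E" using xy less by simp
    have ab: "a \<in> insert x (lower_nbrs x y)" "b \<in> insert x (lower_nbrs x y)"
      using that less.prems unfolding pc[symmetric] by (auto simp: principal_clique_def)
    \<comment> \<open>As \<open>a\<close> and \<open>b\<close> are distinct, one of them is an apex;
      this gives the label above 1 that \<open>principal_clique_child\<close> requires.\<close>
    then have "lower_nbrs x y \<noteq> {}" using less.prems by auto
    then have "card (lower_nbrs x y) > 0" using finite_lower_nbrs by (simp add: card_gt_0_iff)
    then have "lab {x, y} > 1" using card_lower_nbrs[OF xyE] by simp
    then obtain x' y' where c: "{x', y'} \<in> E" "lab {x', y'} < lab {x, y}"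
      "principal_clique x' y' = insert x (lower_nbrs x y)"
      using principal_clique_child[OF xyE] by metis
    have "principal_clique a b \<subseteq> principal_clique x' y'"
      using less.hyps[of x' y'] c ab xy less.prems by auto
    also have "\<dots> \<subseteq> principal_clique x y" using c by (auto simp: principal_clique_def)
    finally show ?thesis using pc by simp
  qed
  show ?case
  proof (cases "{a, b} = {u, v}")
    case True
    then show ?thesis using principal_clique_commute by (auto simp: doubleton_eq_iff)
  next
    case False
    moreover have "u \<noteq> v" using less.prems edge_irrefl by auto
    ultimately have "v \<noteq> a \<and> v \<noteq> b \<or> u \<noteq> a \<and> u \<noteq> b" using less.prems by auto
    then show ?thesis using step[of u v] step[of v u] by (auto simp: insert_commute)
  qed
qed

text \<open>The triangle \<open>wxy\<close> lies in the principal clique of its largest edge. By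
  monotonicity this clique contains that of \<open>xy\<close>, hence both \<open>z\<close> and
  \<open>w\<close>.\<close>

lemma lower_nbr_adjacent_apex:
  assumes xy: "{x, y} \<in> E" and wx: "{w, x} \<in> E" and wy: "{w, y} \<in> E"
    and z: "z \<in> lower_nbrs x y" "z \<noteq> w"
  shows "{z, w} \<in> E"
proof -
  have ne: "x \<noteq> y" "w \<noteq> x" "w \<noteq> y" using assms edge_irrefl by auto
  have "\<exists>a b. {a, b} \<in> E \<and> {w, x, y} \<subseteq> principal_clique a b"
  proof -
    consider "lab {x, y} \<le> lab {w, x}" "lab {w, y} \<le> lab {w, x}"
      | "lab {x, y} \<le> lab {w, y}" "lab {w, x} \<le> lab {w, y}"
      | "lab {w, x} \<le> lab {x, y}" "lab {w, y} \<le> lab {x, y}" by linarith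
    then show ?thesis
    proof cases
      case 1
      then have "y \<in> lower_nbrs w x" using assms by (intro triangle_max_strict) auto
      then show ?thesis using wx by (auto simp: principal_clique_def)
    next
      case 2
      then have "x \<in> lower_nbrs w y"
        using assms by (intro triangle_max_strict) (auto simp: insert_commute)
      then show ?thesis using wy by (auto simp: principal_clique_def)
    next
      case 3
      then have "w \<in> lower_nbrs x y"
        using assms by (intro triangle_max_strict) (auto simp: insert_commute)
      then show ?thesis using xy by (auto simp: principal_clique_def)
    qed
  qed
  then obtain a b where ab: "{a, b} \<in> E" "{w, x, y} \<subseteq> principal_clique a b" by blast
  then have "principal_clique x y \<subseteq> principal_clique a b"
    using principal_clique_mono[OF ab(1), of x y] ne by simp
  then have "z \<in> principal_clique a b" using z by (auto simp: principal_clique_def)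
  then show ?thesis using principal_clique_clique[OF ab(1)] ab(2) z by (auto simp: clique_def)
qed

section \<open>Chordality of the whole graph and exclusion of suns\<close>

lemma chordal: "chordal V E"
  unfolding chordal_def
proof (intro notI, elim exE conjE)
  fix n :: nat assume n: "n > 3" and "has_induced_copy V E {..<n} (cycle_edges n)"
  then obtain W f where bij: "bij_betw f W {..<n}"
    and iso: "\<And>x y. x \<in> W \<Longrightarrow> y \<in> W \<Longrightarrow> {x, y} \<in> induced_edges E W \<longleftrightarrow> {f x, f y} \<in> cycle_edges n"
    unfolding has_induced_copy_def graph_isomorphic_def by blast
  define h where "h = inv_into W f"
  have h: "h i \<in> W" "f (h i) = i" if "i < n" for i
    using bij that by (auto simp: h_def bij_betw_def inv_into_into f_inv_into_f)
  have edge: "{h i, h j} \<in> E \<longleftrightarrow> {i, j} \<in> cycle_edges n" if "i < n" "j < n" for i j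
    using iso[of "h i" "h j"] h that by (auto simp: induced_edges_def)
  let ?p = "map h [0..<n]"
  have "distinct ?p" by (auto simp: distinct_map inj_on_def) (metis h(2))
  moreover have "successively (\<lambda>x y. {x, y} \<in> E) ?p"
    using edge by (intro successively_map_upt) (auto simp: cycle_edges_def)
  moreover have ends: "hd ?p = h 0" "last ?p = h (n - 1)" using n by (auto simp: hd_map last_map)
  moreover have "{n - 1, 0} \<in> cycle_edges n"
    unfolding cycle_edges_def using n by (intro CollectI exI[of _ "n - 1"]) auto
  then have "{h (n - 1), h 0} \<in> E" using edge n by simp
  ultimately have "\<exists>c\<in>set ?p. {h 0, c} \<in> E \<and> {h (n - 1), c} \<in> E"
    using cycles_triangulatedD[OF cycles_triangulated_E, of ?p] n by (simp add: insert_commute)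
  then obtain i where i: "i < n" "{h 0, h i} \<in> E" "{h (n - 1), h i} \<in> E" by auto
  have cyc: "j = Suc i mod n \<or> i = Suc j mod n" if "{i, j} \<in> cycle_edges n" for i j
    using that by (auto simp: cycle_edges_def doubleton_eq_iff)
  from i edge n have "{0, i} \<in> cycle_edges n" "{n - 1, i} \<in> cycle_edges n" by auto
  \<comment> \<open>A common neighbour of \<open>0\<close> and \<open>n - 1\<close> on the cycle
    would have to be both \<open>1\<close> and \<open>n - 2\<close>, which needs
    \<open>n = 3\<close>.\<close>
  from this[THEN cyc] show False using i n by (auto simp: mod_Suc split: if_splits)
qed

lemma sun_free:
  assumes n: "n \<ge> 3"
  shows "\<not> has_induced_copy V E (sun_verts n) (sun_edges n)"
proof
  assume "has_induced_copy V E (sun_verts n) (sun_edges n)"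
  then obtain W f where bij: "bij_betw f W (sun_verts n)"
    and iso: "\<And>x y. x \<in> W \<Longrightarrow> y \<in> W \<Longrightarrow> {x, y} \<in> induced_edges E W \<longleftrightarrow> {f x, f y} \<in> sun_edges n"
    unfolding has_induced_copy_def graph_isomorphic_def by blast
  define h where "h = inv_into W f"
  have h: "h s \<in> W" "f (h s) = s" if "s \<in> sun_verts n" for s
    using bij that by (auto simp: h_def bij_betw_def inv_into_into f_inv_into_f)
  have edge: "{h s, h t} \<in> E \<longleftrightarrow> {s, t} \<in> sun_edges n" if "s \<in> sun_verts n" "t \<in> sun_verts n" for s t
    using iso[of "h s" "h t"] h that by (auto simp: induced_edges_def)
  define u where "u i = h (Inl i)" for i
  define w where "w i = h (Inr i)" for i
  have sv: "Inl i \<in> sun_verts n" "Inr i \<in> sun_verts n" if "i < n" for i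
    using that by (auto simp: sun_verts_def)
  have u_inj: "i = j" if "u i = u j" "i < n" "j < n" for i j
    using that h(2)[OF sv(1)] unfolding u_def by (metis sum.inject(1))
  have uu_less: "{u i, u j} \<in> E" if "i < j" "j < n" for i j
  proof -
    have "{Inl i, Inl j} \<in> sun_edges n" using that unfolding sun_edges_def by blast
    then show ?thesis unfolding u_def using edge sv that by simp
  qed
  have uu: "{u i, u j} \<in> E" if "i < n" "j < n" "i \<noteq> j" for i j
    using that uu_less[of i j] uu_less[of j i] by (cases "i < j") (auto simp: insert_commute)
  have wu: "{w i, u j} \<in> E \<longleftrightarrow> j = i \<or> j = Suc i mod n" if "i < n" "j < n" for i j
    using that edge[OF sv(2) sv(1), of i j] unfolding u_def w_def
    by (auto simp: sun_edges_def doubleton_eq_iff)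
  have w_ne_u: "w i \<noteq> u j" if "i < n" "j < n" for i j
    using that h(2)[OF sv(1), of j] h(2)[OF sv(2), of i] unfolding u_def w_def by auto
  have m: "Suc i mod n < n" "Suc i mod n \<noteq> i" if "i < n" for i
    using that n by (auto simp: mod_Suc)
  have rim: "{u i, u (Suc i mod n)} \<in> E" if "i < n" for i
    using uu[OF that m(1)[OF that]] m(2)[OF that] by simp
  let ?l = "\<lambda>i. lab {u i, u (Suc i mod n)}"
  have "finite {..<n}" "{..<n} \<noteq> {}" using n by (auto simp: lessThan_empty_iff)
  then obtain i where i: "i < n" and max: "\<And>j. j < n \<Longrightarrow> ?l j \<le> ?l i"
    using finite_nonempty_arg_max[of "{..<n}" ?l] by auto
  let ?x = "u i" and ?y = "u (Suc i mod n)"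
  \<comment> \<open>The rim is traversed from \<open>?y\<close> round to \<open>?x\<close>, so that
    the edge of largest label becomes the closing edge.\<close>
  let ?v = "\<lambda>t. u ((Suc i + t) mod n)"
  have cyc: "{?v t, ?v (Suc t)} \<in> L (?l i)" for t
  proof -
    let ?j = "(Suc i + t) mod n"
    have j: "?j < n" "(Suc i + Suc t) mod n = Suc ?j mod n" using n by (auto simp: mod_Suc_eq)
    show ?thesis unfolding j(2) using rim[OF j(1)] max[OF j(1)] by (simp add: L_iff)
  qed
  let ?p = "map ?v [0..<n]"
  have "inj_on ?v {0..<n}"
  proof (rule inj_onI)
    fix s t assume st: "s \<in> {0..<n}" "t \<in> {0..<n}" "?v s = ?v t"
    then have "(Suc i + s) mod n = (Suc i + t) mod n" using u_inj n by simp
    then show "s = t" using st i by (auto simp: mod_if split: if_splits)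
  qed
  then have "distinct ?p" by (simp add: distinct_map)
  moreover have "successively (\<lambda>x y. {x, y} \<in> L (?l i)) ?p"
    using cyc by (intro successively_map_upt)
  moreover have ends: "hd ?p = ?y" "last ?p = ?x"
    using n i by (auto simp: hd_map last_map)
  moreover have "{?x, ?y} \<in> L (?l i)" using rim[OF i] by (simp add: L_iff)
  ultimately have "\<exists>c\<in>set ?p. {?y, c} \<in> L (?l i) \<and> {?x, c} \<in> L (?l i)"
    using cycles_triangulatedD[OF cycles_triangulated_L, of ?p "?l i"] n by (simp add: insert_commute)
  then obtain t where "{?y, ?v t} \<in> L (?l i)" "{?x, ?v t} \<in> L (?l i)" by auto
  then obtain j where j: "j < n" "{?y, u j} \<in> L (?l i)" "{?x, u j} \<in> L (?l i)"
    using n by (metis mod_less_divisor less_le_trans zero_less_numeral)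
  have "u j \<in> lower_nbrs ?x ?y"
    using j rim[OF i] by (intro triangle_max_strict) (auto simp: L_iff)
  \<comment> \<open>The vertex \<open>w i\<close> is adjacent to both ends of the largest rim edge,
    so it is adjacent to every other apex below that edge; in the sun it sees only these two
    ends.\<close>
  then have "{u j, w i} \<in> E"
    using lower_nbr_adjacent_apex[of ?x ?y "w i" "u j"] rim[OF i] m[OF i] wu[OF i] i j w_ne_u[OF i j(1)]
    by auto
  then have "j = i \<or> j = Suc i mod n" using wu[OF i j(1)] by (simp add: insert_commute)
  then show False using j edge_irrefl by (auto simp: L_iff)
qed

end

theorem theorem4p10:
  fixes V :: "'a set" and E :: "'a set set"
  assumes "simple_graph V E"
    and "\<exists>lab. MAT_labeling V E lab"
  shows "strongly_chordal V E"
proof -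
  from assms obtain lab where "MAT_graph V E lab" by (auto simp: MAT_graph_def)
  then show ?thesis
    using MAT_graph.chordal MAT_graph.sun_free unfolding strongly_chordal_def by blast
qed

end
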